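(* Let $q\in\mathbb{N}$, let $T$ be a $(q+1)$-homogeneous tree rooted at $o$ and let $\phi:T\to T$ be a self map. Then $C_\phi$ is compact on $\mathbb{T}_\infty$ if and only if $\phi$ is a bounded self map of $T$.
   Context: $\mathbb{N}=\{1,2,\ldots\}$, $\mathbb{N}_0=\mathbb{N}\cup\{0\}$. A $(q+1)$-homogeneous tree is an (infinite) connected graph without cycles in which every vertex has exactly $q+1$ neighbours; it is rooted at a fixed vertex $o$. We identify $T$ with its vertex set, and $|v|$ denotes the number of edges in the unique path from $o$ to $v$. A self map of $T$ is an arbitrary function $\phi:T\to T$ on vertices; it is called bounded if $\sup\{|\phi(v)| : v\in T\}<\infty$. For $f:T\to\mathbb{C}$ put $M_\infty(n,f)=\max_{|v|=n}|f(v)|$ for $n\in\mathbb{N}_0$, and $\|f\|_\infty=\sup_{n\in\mathbb{N}_0}M_\infty(n,f)$. The space is $\mathbb{T}_\infty=\{f:T\to\mathbb{C} : \|f\|_\infty<\infty\}$, a Banach space under $\|\cdot\|_\infty$. The composition operator is $C_\phi f=f\circ\phi$. $C_\phi$ is compact on $\mathbb{T}_\infty$ if it is a bounded linear operator from $\mathbb{T}_\infty$ to itself and the image $\{C_\phi f : \|f\|_\infty\le 1\}$ of the closed unit ball has compact closure in $\mathbb{T}_\infty$. *)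

theory Defs
  imports "HOL-Analysis.Analysis"
begin

text \<open>A simple undirected graph is a symmetric irreflexive adjacency relation on a vertex type;
  paths and cycles are lists of pairwise distinct vertices, the closing edge of a cycle being
  implicit.\<close>

definition graph_path :: "('v \<Rightarrow> 'v \<Rightarrow> bool) \<Rightarrow> 'v \<Rightarrow> 'v list \<Rightarrow> 'v \<Rightarrow> bool" where
  "graph_path adj u p v \<longleftrightarrow>
     p \<noteq> [] \<and> hd p = u \<and> last p = v \<and> distinct p \<and> successively adj p"

definition graph_cycle :: "('v \<Rightarrow> 'v \<Rightarrow> bool) \<Rightarrow> 'v list \<Rightarrow> bool" where
  "graph_cycle adj p \<longleftrightarrow>
     3 \<le> length p \<and> distinct p \<and> successively adj p \<and> adj (last p) (hd p)"

text \<open>A vertex set with the cardinality of a positive natural number is finite, so the degree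
  condition includes local finiteness.\<close>

definition homogeneous_tree :: "nat \<Rightarrow> ('v \<Rightarrow> 'v \<Rightarrow> bool) \<Rightarrow> bool" where
  "homogeneous_tree q adj \<longleftrightarrow>
     symp adj \<and> irreflp adj \<and>
     (\<forall>u v. \<exists>p. graph_path adj u p v) \<and>
     (\<nexists>p. graph_cycle adj p) \<and>
     (\<forall>v. card {w. adj v w} = q + 1)"

text \<open>The description operator picks the path from the root, which is unique in a tree.\<close>

definition level :: "('v \<Rightarrow> 'v \<Rightarrow> bool) \<Rightarrow> 'v \<Rightarrow> 'v \<Rightarrow> nat" where
  "level adj rt v = length (THE p. graph_path adj rt p v) - 1"

definition bounded_self_map :: "('v \<Rightarrow> 'v \<Rightarrow> bool) \<Rightarrow> 'v \<Rightarrow> ('v \<Rightarrow> 'v) \<Rightarrow> bool" where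
  "bounded_self_map adj rt \<phi> \<longleftrightarrow> bdd_above (range (\<lambda>v. level adj rt (\<phi> v)))"

text \<open>In a homogeneous tree with \<open>q \<ge> 1\<close> every sphere is finite and nonempty, so the maximum
  below is a genuine one.\<close>

definition M_inf :: "('v \<Rightarrow> 'v \<Rightarrow> bool) \<Rightarrow> 'v \<Rightarrow> nat \<Rightarrow> ('v \<Rightarrow> complex) \<Rightarrow> real" where
  "M_inf adj rt n f = Max ((\<lambda>v. cmod (f v)) ` {v. level adj rt v = n})"

definition norm_inf :: "('v \<Rightarrow> 'v \<Rightarrow> bool) \<Rightarrow> 'v \<Rightarrow> ('v \<Rightarrow> complex) \<Rightarrow> ennreal" where
  "norm_inf adj rt f = (SUP n. ennreal (M_inf adj rt n f))"

definition T_inf :: "('v \<Rightarrow> 'v \<Rightarrow> bool) \<Rightarrow> 'v \<Rightarrow> ('v \<Rightarrow> complex) set" where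
  "T_inf adj rt = {f. norm_inf adj rt f < \<infinity>}"

definition dist_inf ::
    "('v \<Rightarrow> 'v \<Rightarrow> bool) \<Rightarrow> 'v \<Rightarrow> ('v \<Rightarrow> complex) \<Rightarrow> ('v \<Rightarrow> complex) \<Rightarrow> real" where
  "dist_inf adj rt f g = enn2real (norm_inf adj rt (\<lambda>v. f v - g v))"

definition topology_inf :: "('v \<Rightarrow> 'v \<Rightarrow> bool) \<Rightarrow> 'v \<Rightarrow> ('v \<Rightarrow> complex) topology" where
  "topology_inf adj rt = Metric_space.mtopology (T_inf adj rt) (dist_inf adj rt)"

definition bounded_linear_operator_inf ::
    "('v \<Rightarrow> 'v \<Rightarrow> bool) \<Rightarrow> 'v \<Rightarrow> (('v \<Rightarrow> complex) \<Rightarrow> ('v \<Rightarrow> complex)) \<Rightarrow> bool" where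
  "bounded_linear_operator_inf adj rt A \<longleftrightarrow>
     A \<in> T_inf adj rt \<rightarrow> T_inf adj rt \<and>
     (\<forall>f\<in>T_inf adj rt. \<forall>g\<in>T_inf adj rt. A (\<lambda>v. f v + g v) = (\<lambda>v. A f v + A g v)) \<and>
     (\<forall>c. \<forall>f\<in>T_inf adj rt. A (\<lambda>v. c * f v) = (\<lambda>v. c * A f v)) \<and>
     (\<exists>K::real. \<forall>f\<in>T_inf adj rt. norm_inf adj rt (A f) \<le> ennreal K * norm_inf adj rt f)"

definition compact_operator_inf ::
    "('v \<Rightarrow> 'v \<Rightarrow> bool) \<Rightarrow> 'v \<Rightarrow> (('v \<Rightarrow> complex) \<Rightarrow> ('v \<Rightarrow> complex)) \<Rightarrow> bool" where
  "compact_operator_inf adj rt A \<longleftrightarrow>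
     bounded_linear_operator_inf adj rt A \<and>
     compactin (topology_inf adj rt)
       (topology_inf adj rt closure_of (A ` {f. norm_inf adj rt f \<le> 1}))"

definition composition_operator ::
    "('v \<Rightarrow> 'v) \<Rightarrow> ('v \<Rightarrow> complex) \<Rightarrow> ('v \<Rightarrow> complex)" where
  "composition_operator \<phi> f = f \<circ> \<phi>"

end

theory Submission
  imports Defs
begin

text \<open>In a homogeneous tree the spheres are finite, so \<open>\<phi>\<close> is bounded if and only if its range is
  finite. If the range is finite, \<open>f \<circ> \<phi>\<close> depends on finitely many values of \<open>f\<close>, and
  Bolzano--Weierstrass on these finitely many coordinates shows that the image of the unit ball is
  itself compact. If the range is infinite, the images of the indicator functions of the points of
  the range have mutual distance 1, so the image of the unit ball is not totally bounded.\<close>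

section \<open>Uniqueness of paths in acyclic graphs\<close>

text \<open>Induction strips the common initial vertices. Where two paths diverge, the stretch up to
  their next meeting point closes to a cycle.\<close>

lemma graph_path_unique:
  assumes sym: "symp adj" and acyc: "\<nexists>p. graph_cycle adj p"
    and "graph_path adj u p v" "graph_path adj u r v"
  shows "p = r"
  using assms(3,4)
proof (induction p arbitrary: u r)
  case Nil
  then show ?case by (simp add: graph_path_def)
next
  case (Cons a p)
  have a: "a = u" and dp: "distinct (u # p)" and sp: "successively adj (u # p)"
    and lp: "last (u # p) = v"
    using Cons.prems(1) by (auto simp: graph_path_def)
  obtain r' where r: "r = u # r'" and dr: "distinct (u # r')" and sr: "successively adj (u # r')"
    and lr: "last (u # r') = v"
    using Cons.prems(2) by (cases r) (auto simp: graph_path_def)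
  show ?case
  proof (cases "p = [] \<or> r' = []")
    case True
    \<comment> \<open>An empty tail means \<open>v = u\<close>, and a nonempty tail ending in
      \<open>v\<close> would then repeat \<open>u\<close>.\<close>
    have "p = [] \<longleftrightarrow> r' = []"
      using lp lr dp dr last_in_set by (metis distinct.simps(2) last.simps)
    with True show ?thesis using a r by simp
  next
    case False
    then have ne: "p \<noteq> []" "r' \<noteq> []" by auto
    show ?thesis
    proof (cases "hd p = hd r'")
      case True
      have "graph_path adj (hd p) p v"
        using ne dp sp lp by (auto simp: graph_path_def successively_Cons)
      moreover have "graph_path adj (hd p) r' v"
        using ne dr sr lr True by (auto simp: graph_path_def successively_Cons)
      ultimately have "p = r'" by (rule Cons.IH)
      then show ?thesis using a r by simp
    next
      case neq: False
      have "\<exists>x\<in>set p. x \<in> set r'"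
        using ne lp lr by (metis last.simps last_in_set)
      then obtain s x t where p: "p = s @ x # t" and x: "x \<in> set r'"
        and s: "\<forall>y\<in>set s. y \<notin> set r'"
        using split_list_first_prop[of p "\<lambda>x. x \<in> set r'"] by auto
      \<comment> \<open>\<open>x\<close> is where \<open>p\<close> first meets \<open>r'\<close> again, so going along \<open>p\<close> to \<open>x\<close> and back along \<open>r'\<close>
        to \<open>u\<close> repeats no vertex.\<close>
      obtain c d where r': "r' = c @ x # d" using x by (meson split_list)
      let ?C = "u # s @ x # rev c"
      have conv: "(\<lambda>x y. adj y x) = adj"
        using sym by (auto simp: fun_eq_iff symp_def)
      \<comment> \<open>If both were empty, \<open>x\<close> would be the head of both tails,
        against \<open>neq\<close>.\<close>
      have "s \<noteq> [] \<or> c \<noteq> []" using neq p r' by auto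
      then have "3 \<le> length ?C" by (cases s; cases c) auto
      moreover have "distinct ?C" using dp dr p r' s by auto
      moreover have "successively adj ?C"
      proof -
        have "successively adj (u # s @ [x])"
          using sp unfolding p
          using successively_append_iff[of adj "u # s @ [x]" t] by simp
        moreover have "successively adj (x # rev c)"
        proof -
          have "successively adj (c @ [x])"
            using sr r' ne
            by (auto simp: successively_Cons successively_append_iff split: if_splits)
          then have "successively adj (rev (c @ [x]))"
            unfolding successively_rev conv .
          then show ?thesis by simp
        qed
        ultimately have "successively adj ((u # s @ [x]) @ rev c)"
          unfolding successively_append_iff by (auto simp: successively_Cons[of adj x])
        then show ?thesis by simp
      qed
      \<comment> \<open>The closing edge is the first edge of \<open>r\<close>, traversed
        backwards.\<close>
      moreover have "adj (last ?C) (hd ?C)"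
      proof -
        have "adj u (hd r')" using sr ne by (auto simp: successively_Cons)
        moreover have "last ?C = hd r'" using r' by (cases c) auto
        ultimately show ?thesis using sym by (auto simp: symp_def)
      qed
      ultimately have "graph_cycle adj ?C" unfolding graph_cycle_def by blast
      then show ?thesis using acyc by blast
    qed
  qed
qed

text \<open>Bolzano-Weierstrass is applied to one point of \<open>A\<close> after another; each
  further subsequence keeps the limits already found.\<close>

lemma finite_pointwise_convergent_subsequence:
  fixes f :: "nat \<Rightarrow> 'a \<Rightarrow> 'b::heine_borel"
  assumes "finite A" and "\<And>x. x \<in> A \<Longrightarrow> bounded (range (\<lambda>n. f n x))"
  shows "\<exists>g r. strict_mono (r :: nat \<Rightarrow> nat) \<and> (\<forall>x\<in>A. (\<lambda>n. f (r n) x) \<longlonglongrightarrow> g x)"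
  using assms
proof (induction A)
  case empty
  show ?case by (auto intro: strict_mono_id)
next
  case (insert a A)
  then obtain g r where r: "strict_mono (r :: nat \<Rightarrow> nat)"
    and g: "\<forall>x\<in>A. (\<lambda>n. f (r n) x) \<longlonglongrightarrow> g x" by auto
  have "bounded (range (\<lambda>n. f (r n) a))"
    by (rule bounded_subset[OF insert.prems[of a]]) auto
  then obtain l s where s: "strict_mono (s :: nat \<Rightarrow> nat)"
    and l: "(\<lambda>n. f (r (s n)) a) \<longlonglongrightarrow> l"
    using bounded_imp_convergent_subsequence[of "\<lambda>n. f (r n) a"] by (auto simp: o_def)
  have "(\<lambda>n. f (r (s n)) x) \<longlonglongrightarrow> g x" if "x \<in> A" for x
    using LIMSEQ_subseq_LIMSEQ[OF _ s, of "\<lambda>n. f (r n) x"] g that by (auto simp: o_def)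
  then have "\<forall>x\<in>insert a A. (\<lambda>n. f ((r \<circ> s) n) x) \<longlonglongrightarrow> (g(a := l)) x"
    using l insert.hyps by auto
  then show ?case using strict_mono_o[OF r s] by blast
qed

section \<open>Levels and spheres in a rooted homogeneous tree\<close>

locale rooted_homogeneous_tree =
  fixes q :: nat and adj :: "'v \<Rightarrow> 'v \<Rightarrow> bool" and rt :: 'v
  assumes q_pos: "q \<ge> 1" and tree: "homogeneous_tree q adj"
begin

lemma sym: "symp adj" and irrefl: "irreflp adj" and acyclic: "\<nexists>p. graph_cycle adj p"
  and connected: "\<exists>p. graph_path adj u p v" and degree: "card {w. adj v w} = q + 1"
  using tree by (auto simp: homogeneous_tree_def)

lemma finite_neighbours: "finite {w. adj v w}"
  using degree[of v] card.infinite by fastforce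

text \<open>Uniqueness of paths lets any path at hand evaluate the description in
  \<open>level\<close>.\<close>

lemma level_eq:
  assumes "graph_path adj rt p v"
  shows "level adj rt v = length p - 1"
proof -
  have "(THE p. graph_path adj rt p v) = p"
    using assms graph_path_unique[OF sym acyclic] by (intro the_equality) auto
  then show ?thesis by (simp add: level_def)
qed

text \<open>Dropping the last vertex of the path from the root to \<open>v\<close> leaves a path to
  the parent of \<open>v\<close>.\<close>

lemma level_SucE:
  assumes "level adj rt v = Suc n"
  obtains w where "level adj rt w = n" "adj w v"
proof -
  obtain p where p: "graph_path adj rt p v" using connected by blast
  have len: "length p = Suc (Suc n)" using level_eq[OF p] assms by simp
  define r where "r = butlast p"
  have pr: "p = r @ [v]"
    using p unfolding r_def graph_path_def by (metis append_butlast_last_id)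
  have r_ne: "r \<noteq> []" using pr len by auto
  have "graph_path adj rt r (last r)" and "adj (last r) v"
    using p r_ne unfolding graph_path_def pr by (auto simp: successively_append_iff)
  moreover have "length r - 1 = n" using len pr by simp
  ultimately show thesis using that level_eq by metis
qed

lemma finite_sphere: "finite {v. level adj rt v = n}"
proof (induction n)
  case 0
  have "v = rt" if "level adj rt v = 0" for v
  proof -
    obtain p where p: "graph_path adj rt p v" using connected by blast
    \<comment> \<open>Truncated subtraction yields only this bound; since paths are nonempty,
      \<open>p\<close> is \<open>[rt]\<close>.\<close>
    then have "length p \<le> 1" using level_eq[OF p] that by simp
    then show ?thesis using p by (cases p) (auto simp: graph_path_def)
  qed
  then have "{v. level adj rt v = 0} \<subseteq> {rt}" by blast
  then show ?case by (rule finite_subset) simp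
next
  case (Suc n)
  have "{v. level adj rt v = Suc n} \<subseteq> (\<Union>w\<in>{w. level adj rt w = n}. {v. adj w v})"
    by (auto elim: level_SucE)
  then show ?case
    by (rule finite_subset) (use Suc finite_neighbours in auto)
qed

text \<open>The degree is at least 2, so \<open>v\<close> has a neighbour other than its predecessor
  on \<open>p\<close>; acyclicity keeps that neighbour off \<open>p\<close>.\<close>

lemma extend_path:
  assumes p: "graph_path adj rt p v"
  obtains w where "graph_path adj rt (p @ [w]) w"
proof -
  \<comment> \<open>For \<open>p = [rt]\<close> there is no predecessor and \<open>last []\<close>
    is an unspecified vertex; excluding one vertex is harmless in any case.\<close>
  have "\<not> {w. adj v w} \<subseteq> {last (butlast p)}"
  proof
    assume "{w. adj v w} \<subseteq> {last (butlast p)}"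
    then have "card {w. adj v w} \<le> card {last (butlast p)}" by (intro card_mono) auto
    then show False using degree[of v] q_pos by simp
  qed
  then obtain w where w: "adj v w" "w \<noteq> last (butlast p)" by blast
  have pd: "p \<noteq> []" "hd p = rt" "last p = v" "distinct p" "successively adj p"
    using p by (auto simp: graph_path_def)
  have "w \<notin> set p"
  proof
    assume "w \<in> set p"
    then obtain s t where st: "p = s @ w # t" by (meson split_list)
    \<comment> \<open>As \<open>w\<close> is neither \<open>v\<close> nor its predecessor on
      \<open>p\<close>, at least two vertices follow it there, so the edge from \<open>v\<close> to
      \<open>w\<close> closes a genuine cycle.\<close>
    have "w \<noteq> v" using w irrefl by (auto simp: irreflp_def)
    then have "t \<noteq> []" using st pd by auto
    moreover have "butlast t \<noteq> []"
    proof
      assume "butlast t = []"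
      then have "p = s @ [w, last t]" using st \<open>t \<noteq> []\<close>
        by (metis append_butlast_last_id append_Nil)
      then show False using w by (simp add: butlast_append)
    qed
    ultimately have "3 \<le> length (w # t)" by (cases t) (auto simp: Suc_le_eq split: if_splits)
    moreover have "distinct (w # t)" "successively adj (w # t)" "last (w # t) = v"
      using pd st \<open>t \<noteq> []\<close> by (auto simp: successively_append_iff)
    ultimately have "graph_cycle adj (w # t)" using w unfolding graph_cycle_def by auto
    then show False using acyclic by blast
  qed
  then have "graph_path adj rt (p @ [w]) w"
    using pd w unfolding graph_path_def by (auto simp: successively_append_iff)
  then show thesis by (rule that)
qed

text \<open>Repeated extension gives paths of every length; \<open>Suc n\<close> vertices make
  \<open>n\<close> edges. This ensures that the \<open>Max\<close> in \<open>M_inf\<close> is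
  attained.\<close>

lemma sphere_nonempty: "{v. level adj rt v = n} \<noteq> {}"
proof -
  have "\<exists>p v. graph_path adj rt p v \<and> length p = Suc n"
  proof (induction n)
    case 0
    have "graph_path adj rt [rt] rt" by (simp add: graph_path_def)
    then show ?case by fastforce
  next
    case (Suc n)
    then obtain p v where "graph_path adj rt p v" "length p = Suc n" by blast
    then show ?case by (metis extend_path length_append_singleton)
  qed
  then show ?thesis using level_eq by fastforce
qed

section \<open>The supremum norm and its metric\<close>

text \<open>The spheres cover all vertices, and on each of them the maximum is attained. Norm
  estimates thereby reduce to pointwise bounds.\<close>

lemma norm_inf_eq_SUP: "norm_inf adj rt f = (SUP v. ennreal (cmod (f v)))"
proof (rule antisym)
  show "norm_inf adj rt f \<le> (SUP v. ennreal (cmod (f v)))"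
    unfolding norm_inf_def
  proof (rule SUP_least)
    fix n
    have "M_inf adj rt n f \<in> (\<lambda>v. cmod (f v)) ` {v. level adj rt v = n}"
      unfolding M_inf_def using finite_sphere sphere_nonempty by (intro Max_in) auto
    then obtain v where "M_inf adj rt n f = cmod (f v)" by blast
    then show "ennreal (M_inf adj rt n f) \<le> (SUP v. ennreal (cmod (f v)))"
      by (auto intro: SUP_upper)
  qed
  show "(SUP v. ennreal (cmod (f v))) \<le> norm_inf adj rt f"
  proof (rule SUP_least)
    fix v
    have "cmod (f v) \<le> M_inf adj rt (level adj rt v) f"
      unfolding M_inf_def using finite_sphere by (intro Max_ge) auto
    then have "ennreal (cmod (f v)) \<le> ennreal (M_inf adj rt (level adj rt v) f)"
      by (rule ennreal_leI)
    also have "\<dots> \<le> norm_inf adj rt f"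
      unfolding norm_inf_def by (rule SUP_upper) simp
    finally show "ennreal (cmod (f v)) \<le> norm_inf adj rt f" .
  qed
qed

text \<open>The sign condition is there because \<open>ennreal\<close> sends negative reals to
  0.\<close>

lemma norm_inf_le_iff:
  "c \<ge> 0 \<Longrightarrow> norm_inf adj rt f \<le> ennreal c \<longleftrightarrow> (\<forall>v. cmod (f v) \<le> c)"
  by (simp add: norm_inf_eq_SUP SUP_le_iff)

lemma T_inf_iff: "f \<in> T_inf adj rt \<longleftrightarrow> (\<exists>c. \<forall>v. cmod (f v) \<le> c)"
proof
  assume "f \<in> T_inf adj rt"
  then have "norm_inf adj rt f < top" by (simp add: T_inf_def infinity_ennreal_def)
  then obtain c where "c \<ge> 0" "norm_inf adj rt f = ennreal c"
    by (cases "norm_inf adj rt f") auto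
  then show "\<exists>c. \<forall>v. cmod (f v) \<le> c" using norm_inf_le_iff[of c f] by auto
next
  assume "\<exists>c. \<forall>v. cmod (f v) \<le> c"
  then obtain c where c: "\<forall>v. cmod (f v) \<le> c" by blast
  then have "c \<ge> 0" using norm_ge_zero order_trans by blast
  then have "norm_inf adj rt f \<le> ennreal c" using c norm_inf_le_iff by blast
  then show "f \<in> T_inf adj rt"
    unfolding T_inf_def infinity_ennreal_def
    using ennreal_less_top le_less_trans by blast
qed

lemma T_inf_diff:
  assumes "f \<in> T_inf adj rt" "g \<in> T_inf adj rt"
  shows "(\<lambda>v. f v - g v) \<in> T_inf adj rt"
proof -
  obtain a b where "\<forall>v. cmod (f v) \<le> a" "\<forall>v. cmod (g v) \<le> b"
    using assms by (auto simp: T_inf_iff)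
  then have "\<forall>v. cmod (f v - g v) \<le> a + b"
    by (meson add_mono norm_triangle_ineq4 order_trans)
  then show ?thesis unfolding T_inf_iff by blast
qed

lemma dist_inf_le_iff:
  assumes "f \<in> T_inf adj rt" "g \<in> T_inf adj rt" "c \<ge> 0"
  shows "dist_inf adj rt f g \<le> c \<longleftrightarrow> (\<forall>v. cmod (f v - g v) \<le> c)"
proof -
  \<comment> \<open>Finiteness must be secured first, since \<open>enn2real\<close> sends
    \<open>top\<close> to 0.\<close>
  have "norm_inf adj rt (\<lambda>v. f v - g v) < top"
    using T_inf_diff[OF assms(1,2)] by (simp add: T_inf_def infinity_ennreal_def)
  then have "dist_inf adj rt f g \<le> c \<longleftrightarrow> norm_inf adj rt (\<lambda>v. f v - g v) \<le> ennreal c"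
    using assms(3) unfolding dist_inf_def
    by (cases "norm_inf adj rt (\<lambda>v. f v - g v)") auto
  then show ?thesis using norm_inf_le_iff[OF assms(3)] by simp
qed

lemma dist_inf_nonneg: "0 \<le> dist_inf adj rt f g"
  by (simp add: dist_inf_def)

lemma cmod_diff_le_dist_inf:
  assumes "f \<in> T_inf adj rt" "g \<in> T_inf adj rt"
  shows "cmod (f v - g v) \<le> dist_inf adj rt f g"
  using dist_inf_le_iff[OF assms dist_inf_nonneg] by blast

lemma Metric_space_inf: "Metric_space (T_inf adj rt) (dist_inf adj rt)"
proof
  show "0 \<le> dist_inf adj rt f g" for f g by (rule dist_inf_nonneg)
  show "dist_inf adj rt f g = dist_inf adj rt g f" for f g
    by (simp add: dist_inf_def norm_inf_eq_SUP norm_minus_commute)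
  show "dist_inf adj rt f g = 0 \<longleftrightarrow> f = g"
    if "f \<in> T_inf adj rt" "g \<in> T_inf adj rt" for f g
    using dist_inf_le_iff[OF that, of 0] dist_inf_nonneg[of f g] by (auto simp: fun_eq_iff)
  show "dist_inf adj rt f h \<le> dist_inf adj rt f g + dist_inf adj rt g h"
    if f: "f \<in> T_inf adj rt" and g: "g \<in> T_inf adj rt" and h: "h \<in> T_inf adj rt" for f g h
  proof -
    have "cmod (f v - h v) \<le> dist_inf adj rt f g + dist_inf adj rt g h" for v
      using norm_triangle_ineq[of "f v - g v" "g v - h v"]
        cmod_diff_le_dist_inf[OF f g, of v] cmod_diff_le_dist_inf[OF g h, of v] by simp
    then show ?thesis
      using dist_inf_le_iff[OF f h] dist_inf_nonneg by (meson add_nonneg_nonneg)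
  qed
qed

sublocale inf: Metric_space "T_inf adj rt" "dist_inf adj rt"
  by (rule Metric_space_inf)

section \<open>Composition operators: boundedness and compactness\<close>

text \<open>\<open>f \<circ> \<phi>\<close> takes only values of \<open>f\<close>, so the norm does
  not grow and \<open>K = 1\<close> serves.\<close>

lemma bounded_linear_composition_operator:
  "bounded_linear_operator_inf adj rt (composition_operator \<phi>)"
  unfolding bounded_linear_operator_inf_def
proof (intro conjI)
  show "composition_operator \<phi> \<in> T_inf adj rt \<rightarrow> T_inf adj rt"
    by (rule funcsetI) (metis T_inf_iff composition_operator_def comp_apply)
  have "norm_inf adj rt (composition_operator \<phi> f) \<le> norm_inf adj rt f" for f
    unfolding norm_inf_eq_SUP composition_operator_def
    by (auto intro!: SUP_least intro: SUP_upper)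
  then show "\<exists>K. \<forall>f\<in>T_inf adj rt.
      norm_inf adj rt (composition_operator \<phi> f) \<le> ennreal K * norm_inf adj rt f"
    by (intro exI[of _ 1]) simp
qed (auto simp: composition_operator_def fun_eq_iff)

text \<open>Balls about the root are finite unions of finite spheres; conversely, finitely many
  values have finitely many levels.\<close>

lemma bounded_self_map_iff_finite_range:
  "bounded_self_map adj rt \<phi> \<longleftrightarrow> finite (range \<phi>)"
proof
  assume "bounded_self_map adj rt \<phi>"
  then obtain n where "\<forall>v. level adj rt (\<phi> v) \<le> n"
    by (auto simp: bounded_self_map_def bdd_above_def)
  then have "range \<phi> \<subseteq> (\<Union>k\<le>n. {v. level adj rt v = k})" by auto
  then show "finite (range \<phi>)"
    by (rule finite_subset) (simp add: finite_sphere)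
next
  assume "finite (range \<phi>)"
  then have "finite (level adj rt ` range \<phi>)" by blast
  then show "bounded_self_map adj rt \<phi>"
    by (simp add: bounded_self_map_def bdd_above_finite image_image)
qed

lemma unit_ball_iff: "norm_inf adj rt f \<le> 1 \<longleftrightarrow> (\<forall>v. cmod (f v) \<le> 1)"
  using norm_inf_le_iff[of 1 f] by simp

lemma finite_range_if_compact:
  assumes "compact_operator_inf adj rt (composition_operator \<phi>)"
  shows "finite (range \<phi>)"
proof -
  let ?B = "composition_operator \<phi> ` {f. norm_inf adj rt f \<le> 1}"
  \<comment> \<open>\<open>e x\<close> is the indicator of the fibre of \<phi> over
    \<open>x\<close>, which is the image of the indicator of \<open>x\<close>. Fibres over distinct
    points are disjoint.\<close>
  define e where "e x = (\<lambda>v. if \<phi> v = x then 1 else 0 :: complex)" for x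
  have eB: "e x \<in> ?B" for x
  proof
    show "e x = composition_operator \<phi> (\<lambda>v. if v = x then 1 else 0)"
      by (auto simp: e_def composition_operator_def)
  qed (simp add: unit_ball_iff)
  have eT: "e x \<in> T_inf adj rt" for x
    unfolding T_inf_iff by (rule exI[of _ 1]) (simp add: e_def)
  have "compactin inf.mtopology (inf.mtopology closure_of ?B)"
    using assms by (simp add: compact_operator_inf_def topology_inf_def)
  then have "inf.mtotally_bounded (inf.mtopology closure_of ?B)"
    by (rule inf.compactin_imp_mtotally_bounded)
  moreover have "e ` range \<phi> \<subseteq> inf.mtopology closure_of ?B"
  proof -
    \<comment> \<open>A set lies in its closure only as far as it lies in the space, hence the use
      of \<open>eT\<close>.\<close>
    have "e x \<in> inf.mtopology closure_of ?B" for x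
      using closure_of_subset_Int[of inf.mtopology ?B] eB[of x] eT[of x] by auto
    then show ?thesis by blast
  qed
  ultimately have "inf.mtotally_bounded (e ` range \<phi>)"
    by (rule inf.mtotally_bounded_subset)
  then obtain K where K: "finite K" "K \<subseteq> e ` range \<phi>"
    and cov: "e ` range \<phi> \<subseteq> (\<Union>g\<in>K. inf.mball g (1/2))"
    unfolding inf.mtotally_bounded_def by (meson half_gt_zero_iff zero_less_one)
  \<comment> \<open>The centres are themselves of the form \<open>e y\<close>, and radius 1/2 is
    below the mutual distance 1, so each \<open>e x\<close> must be its own centre.\<close>
  have "e x \<in> K" if x: "x \<in> range \<phi>" for x
  proof -
    obtain g where g: "g \<in> K" "e x \<in> inf.mball g (1/2)" using cov x by blast
    then obtain y where y: "g = e y" using K by blast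
    obtain v where v: "\<phi> v = x" using x by blast
    have "cmod (e y v - e x v) < 1"
      using cmod_diff_le_dist_inf[OF eT eT, of y v x] g y by auto
    then have "y = x" using v by (auto simp: e_def split: if_splits)
    then show ?thesis using g y by simp
  qed
  then have "finite (e ` range \<phi>)" using K by (meson finite_subset image_subsetI)
  \<comment> \<open>Injectivity needs nonempty fibres: off the range, \<open>e x\<close> is the zero
    function.\<close>
  moreover have "inj_on e (range \<phi>)"
  proof (rule inj_onI)
    fix x y assume "x \<in> range \<phi>" "e x = e y"
    then obtain v where "\<phi> v = x" "e x v = e y v" by auto
    then show "x = y" by (auto simp: e_def split: if_splits)
  qed
  ultimately show ?thesis by (rule finite_imageD)
qed

text \<open>Sequential compactness is used: a subsequence converges at each point of the finite
  range, hence uniformly after composing with \<phi>.\<close>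

lemma compactin_image_unit_ball:
  assumes fin: "finite (range \<phi>)"
  shows "compactin inf.mtopology (composition_operator \<phi> ` {f. norm_inf adj rt f \<le> 1})"
    (is "compactin _ ?B")
  unfolding inf.compactin_sequentially
proof (intro conjI allI impI)
  have memT: "h \<in> T_inf adj rt" if "h \<in> ?B" for h
    using that unfolding T_inf_iff
    by (intro exI[of _ 1]) (auto simp: unit_ball_iff composition_operator_def)
  then show "?B \<subseteq> T_inf adj rt" by blast
  fix \<sigma> :: "nat \<Rightarrow> 'v \<Rightarrow> complex"
  assume \<sigma>: "range \<sigma> \<subseteq> ?B"
  then have "\<forall>n. \<exists>f. \<sigma> n = f \<circ> \<phi> \<and> (\<forall>v. cmod (f v) \<le> 1)"
    by (auto simp: unit_ball_iff composition_operator_def image_subset_iff image_iff)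
  then obtain f where f: "\<And>n. \<sigma> n = f n \<circ> \<phi>" "\<And>n v. cmod (f n v) \<le> 1" by metis
  have "bounded (range (\<lambda>n. f n x))" for x
    using f(2) by (auto simp: bounded_iff)
  then obtain g r where r: "strict_mono (r :: nat \<Rightarrow> nat)"
    and g: "\<forall>x\<in>range \<phi>. (\<lambda>n. f (r n) x) \<longlonglongrightarrow> g x"
    using finite_pointwise_convergent_subsequence[OF fin, of f] by blast
  \<comment> \<open>Off the range \<open>g\<close> is arbitrary; the value 0 keeps \<open>h\<close>
    in the unit ball and leaves \<open>h \<circ> \<phi>\<close> unchanged.\<close>
  define h where "h x = (if x \<in> range \<phi> then g x else 0)" for x
  have "cmod (g x) \<le> 1" if "x \<in> range \<phi>" for x
  proof (rule LIMSEQ_le_const2)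
    show "(\<lambda>n. cmod (f (r n) x)) \<longlonglongrightarrow> cmod (g x)" using g that by (intro tendsto_norm) auto
  qed (use f(2) in auto)
  then have hB: "h \<circ> \<phi> \<in> ?B"
    by (auto simp: unit_ball_iff composition_operator_def h_def intro!: image_eqI[of _ _ h])
  have "limitin inf.mtopology (\<sigma> \<circ> r) (h \<circ> \<phi>) sequentially"
    unfolding inf.limitin_metric
  proof (intro conjI allI impI)
    show "h \<circ> \<phi> \<in> T_inf adj rt" using hB memT by blast
    fix \<epsilon> :: real assume "\<epsilon> > 0"
    \<comment> \<open>Half of \<epsilon> is used because pointwise bounds give only a non-strict
      bound on the supremum.\<close>
    then have "\<forall>x\<in>range \<phi>. \<forall>\<^sub>F n in sequentially. dist (f (r n) x) (g x) < \<epsilon> / 2"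
      using g tendstoD half_gt_zero by blast
    \<comment> \<open>Finiteness of the range turns pointwise into uniform convergence.\<close>
    then have "\<forall>\<^sub>F n in sequentially. \<forall>x\<in>range \<phi>. dist (f (r n) x) (g x) < \<epsilon> / 2"
      by (rule eventually_ball_finite[OF fin])
    then show "\<forall>\<^sub>F n in sequentially. (\<sigma> \<circ> r) n \<in> T_inf adj rt \<and>
        dist_inf adj rt ((\<sigma> \<circ> r) n) (h \<circ> \<phi>) < \<epsilon>"
    proof eventually_elim
      case (elim n)
      have T: "\<sigma> (r n) \<in> T_inf adj rt" using \<sigma> memT by blast
      have "cmod (\<sigma> (r n) v - (h \<circ> \<phi>) v) \<le> \<epsilon> / 2" for v
        using elim f(1)[of "r n"] by (auto simp: dist_norm h_def intro: less_imp_le)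
      then have "dist_inf adj rt (\<sigma> (r n)) (h \<circ> \<phi>) \<le> \<epsilon> / 2"
        using dist_inf_le_iff[OF T memT[OF hB], of "\<epsilon> / 2"] \<open>\<epsilon> > 0\<close> by simp
      then show ?case using T \<open>\<epsilon> > 0\<close> by simp
    qed
  qed
  then show "\<exists>l r. l \<in> ?B \<and> strict_mono r \<and> limitin inf.mtopology (\<sigma> \<circ> r) l sequentially"
    using hB r by blast
qed

text \<open>A compact set in a Hausdorff space is closed, so the image of the unit ball is its own
  closure.\<close>

lemma compact_if_finite_range:
  assumes "finite (range \<phi>)"
  shows "compact_operator_inf adj rt (composition_operator \<phi>)"
proof -
  let ?B = "composition_operator \<phi> ` {f. norm_inf adj rt f \<le> 1}"
  have B: "compactin inf.mtopology ?B" by (rule compactin_image_unit_ball[OF assms])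
  then have "inf.mtopology closure_of ?B = ?B"
    using compactin_imp_closedin[OF inf.Hausdorff_space_mtopology] closure_of_closedin by blast
  then show ?thesis
    using B bounded_linear_composition_operator
    by (simp add: compact_operator_inf_def topology_inf_def)
qed

end

theorem corollary5:
  fixes q :: nat
    and adj :: "'v \<Rightarrow> 'v \<Rightarrow> bool"
    and rt :: 'v
    and \<phi> :: "'v \<Rightarrow> 'v"
  assumes "q \<ge> 1"
    and "homogeneous_tree q adj"
  shows "compact_operator_inf adj rt (composition_operator \<phi>) \<longleftrightarrow> bounded_self_map adj rt \<phi>"
proof -
  interpret rooted_homogeneous_tree q adj rt
    using assms by unfold_locales
  show ?thesis
    using finite_range_if_compact compact_if_finite_range bounded_self_map_iff_finite_range
    by blast
qed

end
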